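(* Let $p=p(n)\in[0,1]$ satisfy $p\le 1-\frac{3\log n}{n}$. Then, with high probability, $\mathrm{tc}_2(G(n,n,p))\ge 3$.
   Context: $G(n,m,p)$ denotes the binomial random bipartite graph: its vertex classes are disjoint copies of $[n]$ and $[m]$, and each possible edge between the two classes appears independently with probability $p$. $\log$ is the natural logarithm. "With high probability" means with probability $1-o(1)$ as $n\to\infty$. A $2$-colouring of a graph $G$ is an arbitrary colouring of the edges of $G$ with up to $2$ colours. A monochromatic tree is a subgraph of $G$ that is a tree all of whose edges have the same colour (a single vertex counts as a monochromatic tree). $\mathrm{tc}_2(G)$ is the smallest integer $k$ such that, in every $2$-colouring of $G$, the vertex set $V(G)$ can be covered by at most $k$ monochromatic trees (not necessarily disjoint, and different trees may have different colours). *)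

theory Defs
  imports "HOL-Probability.Probability"
begin

text \<open>
  A simple graph is a pair of a vertex set and a set of edges, each edge being a
  two-element set of vertices.
\<close>

type_synonym 'a graph = "'a set \<times> 'a set set"

abbreviation verts :: "'a graph \<Rightarrow> 'a set" where "verts \<equiv> fst"
abbreviation edges :: "'a graph \<Rightarrow> 'a set set" where "edges \<equiv> snd"

definition simple_graph :: "'a graph \<Rightarrow> bool" where
  "simple_graph G \<longleftrightarrow> (\<forall>e\<in>edges G. e \<subseteq> verts G \<and> card e = 2)"

definition is_subgraph :: "'a graph \<Rightarrow> 'a graph \<Rightarrow> bool" where
  "is_subgraph H G \<longleftrightarrow> simple_graph H \<and> verts H \<subseteq> verts G \<and> edges H \<subseteq> edges G"

definition connected_graph :: "'a graph \<Rightarrow> bool" where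
  "connected_graph G \<longleftrightarrow> verts G \<noteq> {} \<and>
     (\<forall>u\<in>verts G. \<forall>v\<in>verts G. (u, v) \<in> {(x, y). {x, y} \<in> edges G}\<^sup>*)"

text \<open>A cycle is given by the list of its (at least three, distinct) vertices in cyclic order.\<close>

definition is_cycle :: "'a graph \<Rightarrow> 'a list \<Rightarrow> bool" where
  "is_cycle G xs \<longleftrightarrow> length xs \<ge> 3 \<and> distinct xs \<and>
     (\<forall>i<length xs. {xs ! i, xs ! (Suc i mod length xs)} \<in> edges G)"

definition is_tree :: "'a graph \<Rightarrow> bool" where
  "is_tree T \<longleftrightarrow> simple_graph T \<and> connected_graph T \<and> (\<nexists>xs. is_cycle T xs)"

text \<open>The colours are \<open>0, \<dots>, r - 1\<close>; not all of them need to be used.\<close>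

definition edge_colouring :: "nat \<Rightarrow> 'a graph \<Rightarrow> ('a set \<Rightarrow> nat) \<Rightarrow> bool" where
  "edge_colouring r G c \<longleftrightarrow> (\<forall>e\<in>edges G. c e < r)"

definition mono_tree :: "'a graph \<Rightarrow> ('a set \<Rightarrow> nat) \<Rightarrow> 'a graph \<Rightarrow> bool" where
  "mono_tree G c T \<longleftrightarrow> is_subgraph T G \<and> is_tree T \<and> (\<exists>k. \<forall>e\<in>edges T. c e = k)"

text \<open>
  The tree cover number. On a finite graph the minimum is over a nonempty set, since the
  single vertices form a cover by monochromatic trees.
\<close>

definition tc :: "nat \<Rightarrow> 'a graph \<Rightarrow> nat" where
  "tc r G = (LEAST k. \<forall>c. edge_colouring r G c \<longrightarrow>
     (\<exists>\<T>. finite \<T> \<and> card \<T> \<le> k \<and> (\<forall>T\<in>\<T>. mono_tree G c T) \<and> (\<Union>T\<in>\<T>. verts T) = verts G))"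

definition bipartite_graph :: "nat \<Rightarrow> nat \<Rightarrow> (nat \<times> nat \<Rightarrow> bool) \<Rightarrow> (nat + nat) graph" where
  "bipartite_graph n m f =
     (Inl ` {1..n} \<union> Inr ` {1..m},
      {{Inl i, Inr j} | i j. i \<in> {1..n} \<and> j \<in> {1..m} \<and> f (i, j)})"

definition random_bipartite_graph :: "nat \<Rightarrow> nat \<Rightarrow> real \<Rightarrow> (nat + nat) graph pmf" where
  "random_bipartite_graph n m p =
     map_pmf (bipartite_graph n m) (Pi_pmf ({1..n} \<times> {1..m}) False (\<lambda>_. bernoulli_pmf p))"

end

theory Submission
  imports Defs "HOL-Real_Asymp.Real_Asymp"
begin

text \<open>
  Let \<open>x\<close> be a vertex of the first class with two non-neighbours \<open>y\<close>, \<open>z\<close> in the second.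
  Put every vertex into a cell of a \<open>3 \<times> 3\<close> grid: \<open>x\<close> into (2,2), \<open>y\<close> into (3,1), \<open>z\<close>
  into (1,3), the rest of the first class into (1,1) and the rest of the second into (1,2). Then
  adjacent vertices always share a row or a column. Colour an edge red if its ends share a
  row and blue otherwise: a monochromatic tree lies in a single row or a single column, so no
  such tree contains two of \<open>x\<close>, \<open>y\<close>, \<open>z\<close>, and three trees are needed.
  A fixed \<open>x\<close> has a non-neighbour in each half of the second class with high
  probability.
\<close>

lemma connected_graph_const:
  assumes "connected_graph T" "u \<in> verts T" "v \<in> verts T"
    and step: "\<And>x y. {x, y} \<in> edges T \<Longrightarrow> h x = h y"
  shows "h u = h v"
proof -
  have "(u, v) \<in> {(x, y). {x, y} \<in> edges T}\<^sup>*"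
    using assms(1-3) unfolding connected_graph_def by blast
  then show ?thesis
    by (induction rule: rtrancl_induct) (auto dest: step)
qed

lemma mono_tree_singleton:
  assumes "v \<in> verts G"
  shows "mono_tree G c ({v}, {})"
proof -
  have "\<not> is_cycle ({v}, {}) xs" for xs
    by (auto simp: is_cycle_def intro!: exI[of _ 0])
  then show ?thesis
    using assms by (auto simp: mono_tree_def is_subgraph_def simple_graph_def is_tree_def
        connected_graph_def)
qed

text \<open>Each tree of a cover contains at most one point of \<open>S\<close>, so sending a point
  of \<open>S\<close> to a tree that covers it is injective.\<close>

lemma card_le_tc:
  assumes fin: "finite (verts G)" and col: "edge_colouring r G c" and S: "S \<subseteq> verts G"
    and sep: "\<And>T u v. \<lbrakk>mono_tree G c T; u \<in> S; v \<in> S; u \<in> verts T; v \<in> verts T\<rbrakk> \<Longrightarrow> u = v"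
  shows "card S \<le> tc r G"
proof -
  let ?P = "\<lambda>k. \<forall>c. edge_colouring r G c \<longrightarrow>
     (\<exists>\<T>. finite \<T> \<and> card \<T> \<le> k \<and> (\<forall>T\<in>\<T>. mono_tree G c T) \<and> (\<Union>T\<in>\<T>. verts T) = verts G)"
  \<comment> \<open>\<open>LEAST\<close> is informative only once some \<open>k\<close> qualifies;
    the cover by single vertices provides one.\<close>
  have "?P (card (verts G))"
    by (intro allI impI exI[of _ "(\<lambda>v. ({v}, {})) ` verts G"])
      (auto simp: fin card_image_le mono_tree_singleton)
  then have "?P (tc r G)"
    unfolding tc_def by (rule LeastI)
  from this[THEN spec, THEN mp, OF col] obtain \<T> where \<T>: "finite \<T>" "card \<T> \<le> tc r G" "\<And>T. T \<in> \<T> \<Longrightarrow> mono_tree G c T"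
    "(\<Union>T\<in>\<T>. verts T) = verts G"
    by (elim exE conjE) simp
  have "\<forall>v\<in>S. \<exists>T\<in>\<T>. v \<in> verts T"
    using \<T>(4) S by blast
  then obtain t where t: "\<And>v. v \<in> S \<Longrightarrow> t v \<in> \<T> \<and> v \<in> verts (t v)"
    by metis
  have "inj_on t S"
    by (rule inj_onI) (metis t sep \<T>(3))
  then have "card S \<le> card \<T>"
    using t \<T>(1) by (intro card_inj_on_le) auto
  with \<T>(2) show ?thesis
    by simp
qed

text \<open>A monochromatic tree stays within one row or one column, and by injectivity each of
  these contains at most one point of \<open>S\<close>.\<close>

lemma card_le_tc_grid:
  fixes row :: "'a \<Rightarrow> 'b" and col :: "'a \<Rightarrow> 'c"
  assumes fin: "finite (verts G)" and S: "S \<subseteq> verts G"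
    and share: "\<And>u v. {u, v} \<in> edges G \<Longrightarrow> row u = row v \<or> col u = col v"
    and inj: "inj_on row S" "inj_on col S"
  shows "card S \<le> tc 2 G"
proof -
  \<comment> \<open>Colour 0 is red, 1 is blue. Quantifying over both ends avoids having to order
    the ends of \<open>e\<close>.\<close>
  define c :: "'a set \<Rightarrow> nat" where "c e = (if \<forall>u\<in>e. \<forall>v\<in>e. row u = row v then 0 else 1)" for e
  have line: "row u = row v \<or> col u = col v"
    if T: "mono_tree G c T" and uv: "u \<in> verts T" "v \<in> verts T" for T u v
  proof -
    obtain k where k: "\<And>e. e \<in> edges T \<Longrightarrow> c e = k"
      using T by (auto simp: mono_tree_def)
    have conn: "connected_graph T" and sub: "edges T \<subseteq> edges G"
      using T by (auto simp: mono_tree_def is_tree_def is_subgraph_def)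
    show ?thesis
    \<comment> \<open>A nonzero \<open>k\<close> forces the ends of every tree edge into different
      rows, hence by \<open>share\<close> into one column.\<close>
    proof (cases "k = 0")
      case True
      have "row x = row y" if "{x, y} \<in> edges T" for x y
        using k[OF that] True unfolding c_def by (metis insertCI zero_neq_one)
      from connected_graph_const[OF conn uv this] show ?thesis ..
    next
      case False
      have "col x = col y" if "{x, y} \<in> edges T" for x y
        using k[OF that] False share[of x y] that sub unfolding c_def by (metis insert_iff singletonD subsetD)
      from connected_graph_const[OF conn uv this] show ?thesis ..
    qed
  qed
  show ?thesis
  proof (rule card_le_tc[OF fin _ S])
    show "edge_colouring 2 G c"
      by (auto simp: edge_colouring_def c_def)
    show "u = v" if "mono_tree G c T" "u \<in> S" "v \<in> S" "u \<in> verts T" "v \<in> verts T" for T u v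
      using line[of T u v] that inj by (auto dest: inj_onD)
  qed
qed

lemma tc_bipartite_graph_ge_3:
  assumes "i \<in> {1..n}" "j \<in> {1..m}" "k \<in> {1..m}" "j \<noteq> k" "\<not> f (i, j)" "\<not> f (i, k)"
  shows "3 \<le> tc 2 (bipartite_graph n m f)"
proof -
  \<comment> \<open>Here \<open>i\<close>, \<open>j\<close>, \<open>k\<close> are \<open>x\<close>,
    \<open>y\<close>, \<open>z\<close>; the vertex \<open>Inr k\<close> gets its row 1 by
    default.\<close>
  define row :: "nat + nat \<Rightarrow> nat" where
    "row v = (if v = Inl i then 2 else if v = Inr j then 3 else 1)" for v
  define col :: "nat + nat \<Rightarrow> nat" where
    "col v = (if v = Inl i then 2 else if v = Inr j then 1 else if v = Inr k then 3
              else if isl v then 1 else 2)" for v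
  let ?S = "{Inl i, Inr j, Inr k}"
  have "card ?S \<le> tc 2 (bipartite_graph n m f)"
  proof (rule card_le_tc_grid[where row = row and col = col])
    show "row u = row v \<or> col u = col v" if "{u, v} \<in> edges (bipartite_graph n m f)" for u v
    proof -
      obtain a b where "{u, v} = {Inl a, Inr b}" and "f (a, b)"
        using \<open>{u, v} \<in> _\<close> by (auto simp: bipartite_graph_def)
      \<comment> \<open>Edges at \<open>Inl i\<close> lie in column 2, those at \<open>Inr j\<close>
        in column 1, and all others in row 1.\<close>
      moreover have "row (Inl a) = row (Inr b) \<or> col (Inl a) = col (Inr b)"
        using \<open>f (a, b)\<close> assms(5,6) by (auto simp: row_def col_def)
      ultimately show ?thesis
        unfolding doubleton_eq_iff by metis
    qed
    show "finite (verts (bipartite_graph n m f))"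
      by (simp add: bipartite_graph_def)
    show "?S \<subseteq> verts (bipartite_graph n m f)"
      using assms by (simp add: bipartite_graph_def)
    show "inj_on row ?S" "inj_on col ?S"
      using assms(4) by (simp_all add: row_def col_def)
  qed
  then show ?thesis
    using assms(4) by simp
qed

lemma prob_Pi_bernoulli_all_True:
  assumes "finite A" "B \<subseteq> A" "p \<in> {0..1}"
  shows "measure_pmf.prob (Pi_pmf A d (\<lambda>_. bernoulli_pmf p)) {f. \<forall>x\<in>B. f x} = p ^ card B"
proof -
  have "{f. \<forall>x\<in>B. f x} = Pi A (\<lambda>x. if x \<in> B then {True} else UNIV)"
    using assms(2) by (auto simp: Pi_def split: if_splits)
  then have "measure_pmf.prob (Pi_pmf A d (\<lambda>_. bernoulli_pmf p)) {f. \<forall>x\<in>B. f x} =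
      (\<Prod>x\<in>A. measure_pmf.prob (bernoulli_pmf p) (if x \<in> B then {True} else UNIV))"
    using assms(1) by (simp add: measure_Pi_pmf_Pi)
  also have "\<dots> = (\<Prod>x\<in>A. if x \<in> B then p else 1)"
    using assms(3) by (intro prod.cong) (auto simp: measure_pmf_single)
  also have "\<dots> = p ^ card B"
    using assms(1,2) by (simp add: prod.If_cases Int_absorb1)
  finally show ?thesis .
qed

text \<open>Vertex 1 serves as \<open>x\<close>. A union bound covers the two bad events that
  \<open>x\<close> is joined to all of one half of the second class.\<close>

lemma prob_tc_random_bipartite_graph_ge_3:
  assumes p: "p \<in> {0..1}" and n: "1 \<le> n"
  shows "1 - 2 * p ^ (m div 2) \<le>
    measure_pmf.prob (random_bipartite_graph n m p) {G. tc 2 G \<ge> 3}"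
proof -
  define M where "M = Pi_pmf ({1..n} \<times> {1..m}) False (\<lambda>_. bernoulli_pmf p)"
  define L where "L = {1::nat} \<times> {1..m div 2}"
  \<comment> \<open>For odd \<open>m\<close> this half has one vertex more than \<open>L\<close>;
    \<open>prob_all\<close> absorbs that since \<open>p\<close> is at most 1. Disjoint halves make
    the two non-neighbours distinct.\<close>
  define R where "R = {1::nat} \<times> {m div 2 + 1..m}"
  let ?all = "\<lambda>B::(nat \<times> nat) set. {f. \<forall>x\<in>B. f x}"
  let ?good = "{f. 3 \<le> tc 2 (bipartite_graph n m f)}"
  have prob_all: "measure_pmf.prob M (?all B) \<le> p ^ (m div 2)"
    if "B \<subseteq> {1..n} \<times> {1..m}" "m div 2 \<le> card B" for B
    using prob_Pi_bernoulli_all_True[of "{1..n} \<times> {1..m}" B p False] that p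
    by (simp add: M_def power_decreasing)
  have sub: "- ?good \<subseteq> ?all L \<union> ?all R"
  proof
    fix f assume f: "f \<in> - ?good"
    show "f \<in> ?all L \<union> ?all R"
    proof (rule ccontr)
      assume "f \<notin> ?all L \<union> ?all R"
      then obtain j k where "j \<in> {1..m div 2}" "k \<in> {m div 2 + 1..m}" "\<not> f (1, j)" "\<not> f (1, k)"
        by (auto simp: L_def R_def)
      then have "3 \<le> tc 2 (bipartite_graph n m f)"
        using n by (intro tc_bipartite_graph_ge_3[of 1 n j m k f]) auto
      with f show False by simp
    qed
  qed
  have "1 - measure_pmf.prob M ?good = measure_pmf.prob M (- ?good)"
    using measure_pmf.prob_compl[of ?good M] by (simp add: Compl_eq_Diff_UNIV)
  also have "\<dots> \<le> measure_pmf.prob M (?all L \<union> ?all R)"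
    using sub by (intro measure_pmf.finite_measure_mono) auto
  also have "\<dots> \<le> measure_pmf.prob M (?all L) + measure_pmf.prob M (?all R)"
    by (intro measure_Un_le) auto
  also have "\<dots> \<le> p ^ (m div 2) + p ^ (m div 2)"
    using n by (intro add_mono prob_all) (auto simp: L_def R_def card_cartesian_product)
  finally show ?thesis
    by (simp add: random_bipartite_graph_def M_def vimage_def)
qed

theorem proposition1p2:
  fixes p :: "nat \<Rightarrow> real"
  assumes "\<And>n. p n \<in> {0..1}"
    and "\<forall>\<^sub>F n in sequentially. p n \<le> 1 - 3 * ln (real n) / real n"
  shows "(\<lambda>n. measure_pmf.prob (random_bipartite_graph n n (p n)) {G. tc 2 G \<ge> 3})
           \<longlonglongrightarrow> 1"
proof (rule tendsto_sandwich[where h = "\<lambda>_. 1"])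
  let ?q = "\<lambda>n. 3 * ln (real n) / real n"
  show "\<forall>\<^sub>F n in sequentially. 1 - 2 * exp (- ?q n * ((real n - 1) / 2)) \<le>
      measure_pmf.prob (random_bipartite_graph n n (p n)) {G. tc 2 G \<ge> 3}"
    using assms(2) eventually_ge_at_top[of 1]
  proof eventually_elim
    case (elim n)
    have "p n \<le> exp (- ?q n)"
      using elim(1) exp_ge_add_one_self[of "- ?q n"] by simp
    then have "p n ^ (n div 2) \<le> exp (- ?q n) ^ (n div 2)"
      using assms(1)[of n] by (intro power_mono) auto
    also have "\<dots> = exp (- (?q n * real (n div 2)))"
      by (simp only: exp_of_nat_mult [symmetric] mult_minus_right mult.commute)
    also have "\<dots> \<le> exp (- ?q n * ((real n - 1) / 2))"
    proof -
      \<comment> \<open>Equality holds for odd \<open>n\<close>; the bound removes the rounding for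
        the limit.\<close>
      have "(real n - 1) / 2 \<le> real (n div 2)"
        using of_nat_mono[of n "2 * (n div 2) + 1", where 'a = real] by simp
      moreover have "0 \<le> ?q n"
        using elim(2) by simp
      ultimately have "?q n * ((real n - 1) / 2) \<le> ?q n * real (n div 2)"
        by (rule mult_left_mono)
      then show ?thesis by simp
    qed
    finally show ?case
      using prob_tc_random_bipartite_graph_ge_3[OF assms(1)[of n] elim(2), of n] by linarith
  qed
  \<comment> \<open>The exponential equals \<open>n\<close> to the power
    \<open>-(3/2) * (n - 1) / n\<close>, which tends to 0.\<close>
  show "(\<lambda>n. 1 - 2 * exp (- ?q n * ((real n - 1) / 2))) \<longlonglongrightarrow> 1"
    by real_asymp
qed simp_all

end
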